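(* Let $X=\{x_1,x_2,\dots,x_n\}$ be a finite set equipped with an arbitrary topology, let $N\geq 2$, let $\rho_s$ be a binary relation on $X$ ($1\le s\le N$), and let $\mathcal F$ be a non-empty collection of subsets of $\mathbb N$. Let $[\rho_s]$ be the adjacency matrix of $\rho_s$ and let $a_{ij}^{k;s}$ denote the $(i,j)$ entry of the matrix power $[\rho_s]^k$. (i) For $1\le i\le n$, $x_i$ is a $d\mathcal F$-hypercyclic vector for $\rho_1,\rho_2,\dots,\rho_N$ if and only if for every $k\in\mathbb N$ and $1\le s\le N$ there exists a $\rho_s$-walk of length $k$ starting at $x_i$ and for all open non-empty subsets $V_1,\dots,V_N$ of $X$ we have $$\{k\in\mathbb N:\ \text{for every } 1\le s\le N \text{ there is } j_s \text{ with } x_{j_s}\in V_s \text{ and } a_{ij_s}^{k;s}\geq 1\}\in\mathcal F.$$ (ii) $\rho_1,\dots,\rho_N$ are $d\mathcal F$-topologically transitive if and only if for all open non-empty subsets $U,V_1,\dots,V_N$ of $X$ we have $$\{k\in\mathbb N:\ \text{there is } i \text{ with } x_i\in U \text{ such that for every } 1\le s\le N \text{ there is } j_s \text{ with } x_{j_s}\in V_s \text{ and } a_{ij_s}^{k;s}\geq 1\}\in\mathcal F.$$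
   Context: $\mathbb N=\{1,2,3,\dots\}$. The adjacency matrix of a relation $\rho$ on $X$ has $(i,j)$ entry $1$ if $(x_i,x_j)\in\rho$ and $0$ otherwise. A $\rho$-walk of length $k\in\mathbb N$ starting at $x_{i_1}$ is a finite sequence $x_{i_1}x_{i_2}\cdots x_{i_{k+1}}$ with $(x_{i_j},x_{i_{j+1}})\in\rho$ for $1\le j\le k$. $\rho^k$ is the $k$-fold composition, $\rho^k x:=\{y:(x,y)\in\rho^k\}$, $D(\rho^k):=\{x:\rho^kx\neq\emptyset\}$, $D_\infty(\rho):=\bigcap_{k\in\mathbb N}D(\rho^k)$. An element $x\in X$ is a $d\mathcal F$-hypercyclic vector (element) for $\rho_1,\dots,\rho_N$ if $x\in\bigcap_{s=1}^N D_\infty(\rho_s)$ and for all non-empty open $V_1,\dots,V_N\subseteq X$, $\{k\in\mathbb N:\rho_s^kx\cap V_s\neq\emptyset\text{ for all }1\le s\le N\}\in\mathcal F$. The relations $\rho_1,\dots,\rho_N$ are $d\mathcal F$-topologically transitive if for all non-empty open $U,V_1,\dots,V_N\subseteq X$, $\{k\in\mathbb N:(\exists x\in U)\ \rho_s^kx\cap V_s\neq\emptyset\text{ for all }1\le s\le N\}\in\mathcal F$. *)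

theory Defs
  imports "HOL-Analysis.Abstract_Topology" "Jordan_Normal_Form.Matrix"
begin

text \<open>The set \<open>\<nat> = {1, 2, 3, \<dots>}\<close> is rendered as \<open>{1..} :: nat set\<close>.
  The space \<open>X\<close> is \<open>topspace T\<close>. A tuple of \<open>N\<close> relations (or of \<open>N\<close> open sets) is a function on
  \<open>nat\<close> of which only the values at \<open>1, \<dots>, N\<close> matter.
  The set \<open>\<rho>\<^sup>k x\<close> is the image \<open>(\<rho> ^^ k) `` {x}\<close>.\<close>

definition D_inf :: "('a \<times> 'a) set \<Rightarrow> 'a set" where
  "D_inf \<rho> = (\<Inter>k\<in>{1..}. Domain (\<rho> ^^ k))"

definition walk :: "('a \<times> 'a) set \<Rightarrow> nat \<Rightarrow> 'a \<Rightarrow> 'a list \<Rightarrow> bool" where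
  "walk \<rho> k a ws \<longleftrightarrow>
     length ws = k + 1 \<and> ws ! 0 = a \<and> (\<forall>j<k. (ws ! j, ws ! (j + 1)) \<in> \<rho>)"

text \<open>The enumeration of \<open>X\<close> is shifted to \<open>x 0, \<dots>, x (n - 1)\<close>, so that it agrees with the
  0-based matrix indices.\<close>

definition adjacency_matrix :: "nat \<Rightarrow> (nat \<Rightarrow> 'a) \<Rightarrow> ('a \<times> 'a) set \<Rightarrow> nat mat" where
  "adjacency_matrix n x \<rho> = mat n n (\<lambda>(i, j). if (x i, x j) \<in> \<rho> then 1 else 0)"

definition dF_hypercyclic ::
  "'a topology \<Rightarrow> nat \<Rightarrow> (nat \<Rightarrow> ('a \<times> 'a) set) \<Rightarrow> nat set set \<Rightarrow> 'a \<Rightarrow> bool" where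
  "dF_hypercyclic T N \<rho> \<F> a \<longleftrightarrow>
     a \<in> topspace T \<and> a \<in> (\<Inter>s\<in>{1..N}. D_inf (\<rho> s)) \<and>
     (\<forall>V. (\<forall>s\<in>{1..N}. openin T (V s) \<and> V s \<noteq> {}) \<longrightarrow>
        {k\<in>{1..}. \<forall>s\<in>{1..N}. (\<rho> s ^^ k) `` {a} \<inter> V s \<noteq> {}} \<in> \<F>)"

definition dF_topologically_transitive ::
  "'a topology \<Rightarrow> nat \<Rightarrow> (nat \<Rightarrow> ('a \<times> 'a) set) \<Rightarrow> nat set set \<Rightarrow> bool" where
  "dF_topologically_transitive T N \<rho> \<F> \<longleftrightarrow>
     (\<forall>U V. openin T U \<and> U \<noteq> {} \<and> (\<forall>s\<in>{1..N}. openin T (V s) \<and> V s \<noteq> {}) \<longrightarrow>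
        {k\<in>{1..}. \<exists>a\<in>U. \<forall>s\<in>{1..N}. (\<rho> s ^^ k) `` {a} \<inter> V s \<noteq> {}} \<in> \<F>)"

end

theory Submission
  imports Defs
begin

text \<open>The entry \<open>(i, j)\<close> of the k-th power of an adjacency matrix over the
  naturals counts walks of length k from \<open>x i\<close> to \<open>x j\<close>. Only its
  positivity matters here: nothing cancels in a sum of naturals, so an entry is at least 1 exactly
  when \<open>(x i, x j) \<in> \<rho> ^^ k\<close> (\<open>adjacency_matrix_pow_ge_1_iff\<close>).
  As X is enumerated by \<open>x\<close>, the image of \<open>x i\<close> under the k-th power meets
  V iff some index j witnesses it (\<open>Image_relpow_Int_nonempty_iff\<close>). Hence the sets of
  times k in the definitions and in the matrix conditions are equal, and so are their memberships in
  \<open>\<F>\<close>. Lying in every \<open>D_inf (\<rho> s)\<close> amounts to having walks of all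
  lengths (\<open>ex_walk_iff\<close>).\<close>

lemma one_le_sum_mult_iff:
  fixes f g :: "'a \<Rightarrow> nat"
  assumes "finite A"
  shows "1 \<le> (\<Sum>a\<in>A. f a * g a) \<longleftrightarrow> (\<exists>a\<in>A. 1 \<le> f a \<and> 1 \<le> g a)"
  using sum_eq_0_iff[OF assms, of "\<lambda>a. f a * g a"] by (simp add: Suc_le_eq flip: neq0_conv)

text \<open>Matrix powers and relation powers obey the same recursion, with the new factor on the
  right: the sum over the middle index l becomes the existential over the middle point of the
  composition.\<close>

lemma adjacency_matrix_pow_ge_1_iff:
  assumes bij: "bij_betw x {..<n} X" and sub: "\<rho> \<subseteq> X \<times> X" and "i < n" "j < n"
  shows "(adjacency_matrix n x \<rho> ^\<^sub>m k) $$ (i, j) \<ge> 1 \<longleftrightarrow> (x i, x j) \<in> \<rho> ^^ k"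
  using \<open>j < n\<close>
proof (induction k arbitrary: j)
  case 0
  \<comment> \<open>Power 0 is the identity matrix on one side and \<open>Id\<close> on the other;
    injectivity of \<open>x\<close> matches them.\<close>
  then have "x i = x j \<longleftrightarrow> i = j"
    using bij \<open>i < n\<close> by (auto simp: bij_betw_def inj_on_def)
  then show ?case
    using 0 \<open>i < n\<close> by (auto simp: adjacency_matrix_def)
next
  case (Suc k)
  let ?A = "adjacency_matrix n x \<rho>"
  have A: "?A \<in> carrier_mat n n"
    by (simp add: adjacency_matrix_def)
  have Ak: "?A ^\<^sub>m k \<in> carrier_mat n n"
    using A by simp
  have "(?A ^\<^sub>m Suc k) $$ (i, j) = (\<Sum>l<n. (?A ^\<^sub>m k) $$ (i, l) * ?A $$ (l, j))"
    using A Ak \<open>i < n\<close> Suc.prems by (simp add: scalar_prod_def atLeast0LessThan)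
  then have "(?A ^\<^sub>m Suc k) $$ (i, j) \<ge> 1 \<longleftrightarrow>
      (\<exists>l<n. (?A ^\<^sub>m k) $$ (i, l) \<ge> 1 \<and> ?A $$ (l, j) \<ge> 1)"
    by (simp only: one_le_sum_mult_iff[OF finite_lessThan] lessThan_iff Bex_def)
  also have "\<dots> \<longleftrightarrow> (\<exists>l<n. (x i, x l) \<in> \<rho> ^^ k \<and> (x l, x j) \<in> \<rho>)"
  proof -
    have "?A $$ (l, j) \<ge> 1 \<longleftrightarrow> (x l, x j) \<in> \<rho>" if "l < n" for l
      using that Suc.prems by (simp add: adjacency_matrix_def)
    then show ?thesis
      using Suc.IH by blast
  qed
  also have "\<dots> \<longleftrightarrow> (x i, x j) \<in> \<rho> ^^ Suc k"
  proof -
    \<comment> \<open>The middle point of a composition lies in X because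
      \<open>\<rho> \<subseteq> X \<times> X\<close>, so it carries an index.\<close>
    have "\<exists>l<n. y = x l" if "(y, x j) \<in> \<rho>" for y
      using that sub bij by (auto simp: bij_betw_def)
    then show ?thesis
      unfolding relpow.simps by blast
  qed
  finally show ?case .
qed

lemma Image_relpow_Int_nonempty_iff:
  assumes bij: "bij_betw x {..<n} X" and sub: "\<rho> \<subseteq> X \<times> X" and "i < n" "V \<subseteq> X"
  shows "(\<rho> ^^ k) `` {x i} \<inter> V \<noteq> {} \<longleftrightarrow>
    (\<exists>j<n. x j \<in> V \<and> (adjacency_matrix n x \<rho> ^\<^sub>m k) $$ (i, j) \<ge> 1)"
proof -
  have "\<exists>j<n. y = x j" if "y \<in> V" for y
    using that \<open>V \<subseteq> X\<close> bij by (auto simp: bij_betw_def)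
  then have "(\<rho> ^^ k) `` {x i} \<inter> V \<noteq> {} \<longleftrightarrow> (\<exists>j<n. x j \<in> V \<and> (x i, x j) \<in> \<rho> ^^ k)"
    by blast
  also have "\<dots> \<longleftrightarrow> (\<exists>j<n. x j \<in> V \<and> (adjacency_matrix n x \<rho> ^\<^sub>m k) $$ (i, j) \<ge> 1)"
    using adjacency_matrix_pow_ge_1_iff[OF bij sub \<open>i < n\<close>] by blast
  finally show ?thesis .
qed

text \<open>\<open>relpow_fun_conv\<close> describes a pair in the k-th power by a chain indexed by
  naturals; a walk is the same chain stored as a list.\<close>

lemma ex_walk_iff: "(\<exists>ws. walk \<rho> k a ws) \<longleftrightarrow> a \<in> Domain (\<rho> ^^ k)"
proof
  assume "\<exists>ws. walk \<rho> k a ws"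
  then obtain ws where "ws ! 0 = a" "\<forall>j<k. (ws ! j, ws ! Suc j) \<in> \<rho>"
    by (auto simp: walk_def)
  then have "(a, ws ! k) \<in> \<rho> ^^ k"
    unfolding relpow_fun_conv by (intro exI[of _ "(!) ws"]) simp
  then show "a \<in> Domain (\<rho> ^^ k)" ..
next
  assume "a \<in> Domain (\<rho> ^^ k)"
  then obtain f where "f 0 = a" "\<forall>j<k. (f j, f (Suc j)) \<in> \<rho>"
    by (auto simp: relpow_fun_conv)
  \<comment> \<open>A walk with k steps has the k + 1 vertices \<open>f 0\<close>, ...,
    \<open>f k\<close>.\<close>
  then have "walk \<rho> k a (map f [0..<k + 1])"
    by (auto simp: walk_def simp del: upt_Suc)
  then show "\<exists>ws. walk \<rho> k a ws" ..
qed

theorem proposition3p4: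
  fixes T :: "'a topology" and n N :: nat and x :: "nat \<Rightarrow> 'a"
    and \<rho> :: "nat \<Rightarrow> ('a \<times> 'a) set" and \<F> :: "nat set set"
  assumes "bij_betw x {..<n} (topspace T)"
    and "N \<ge> 2"
    and "\<And>s. s \<in> {1..N} \<Longrightarrow> \<rho> s \<subseteq> topspace T \<times> topspace T"
    and "\<F> \<noteq> {}" and "\<F> \<subseteq> Pow {1..}"
  shows
    "(\<forall>i<n. dF_hypercyclic T N \<rho> \<F> (x i) \<longleftrightarrow>
        (\<forall>k\<in>{1..}. \<forall>s\<in>{1..N}. \<exists>ws. walk (\<rho> s) k (x i) ws) \<and>
        (\<forall>V. (\<forall>s\<in>{1..N}. openin T (V s) \<and> V s \<noteq> {}) \<longrightarrow>
           {k\<in>{1..}. \<forall>s\<in>{1..N}. \<exists>j<n. x j \<in> V s \<and>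
              (adjacency_matrix n x (\<rho> s) ^\<^sub>m k) $$ (i, j) \<ge> 1} \<in> \<F>)) \<and>
     (dF_topologically_transitive T N \<rho> \<F> \<longleftrightarrow>
        (\<forall>U V. openin T U \<and> U \<noteq> {} \<and> (\<forall>s\<in>{1..N}. openin T (V s) \<and> V s \<noteq> {}) \<longrightarrow>
           {k\<in>{1..}. \<exists>i<n. x i \<in> U \<and> (\<forall>s\<in>{1..N}. \<exists>j<n. x j \<in> V s \<and>
              (adjacency_matrix n x (\<rho> s) ^\<^sub>m k) $$ (i, j) \<ge> 1)} \<in> \<F>))"
proof -
  let ?a = "\<lambda>s k i j. (adjacency_matrix n x (\<rho> s) ^\<^sub>m k) $$ (i, j)"
  have hit: "(\<forall>s\<in>{1..N}. (\<rho> s ^^ k) `` {x i} \<inter> V s \<noteq> {}) \<longleftrightarrow>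
      (\<forall>s\<in>{1..N}. \<exists>j<n. x j \<in> V s \<and> ?a s k i j \<ge> 1)"
    if "i < n" "\<forall>s\<in>{1..N}. openin T (V s) \<and> V s \<noteq> {}" for i k V
  proof (intro ball_cong refl)
    fix s assume "s \<in> {1..N}"
    with that(2) have "V s \<subseteq> topspace T"
      by (blast dest: openin_subset)
    from Image_relpow_Int_nonempty_iff[OF assms(1) assms(3)[OF \<open>s \<in> {1..N}\<close>] \<open>i < n\<close> this]
    show "(\<rho> s ^^ k) `` {x i} \<inter> V s \<noteq> {} \<longleftrightarrow> (\<exists>j<n. x j \<in> V s \<and> ?a s k i j \<ge> 1)" .
  qed
  have hit_set: "{k\<in>{1..}. \<exists>a\<in>U. \<forall>s\<in>{1..N}. (\<rho> s ^^ k) `` {a} \<inter> V s \<noteq> {}} =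
      {k\<in>{1..}. \<exists>i<n. x i \<in> U \<and> (\<forall>s\<in>{1..N}. \<exists>j<n. x j \<in> V s \<and> ?a s k i j \<ge> 1)}"
    if "openin T U" and V: "\<forall>s\<in>{1..N}. openin T (V s) \<and> V s \<noteq> {}" for U V
  proof -
    have U: "\<exists>i<n. a = x i" if "a \<in> U" for a
      using that openin_subset[OF \<open>openin T U\<close>] assms(1) by (auto simp: bij_betw_def)
    have "(\<exists>a\<in>U. P a) \<longleftrightarrow> (\<exists>i<n. x i \<in> U \<and> P (x i))" for P
      using U by blast
    then show ?thesis
      \<comment> \<open>\<open>conj_cong\<close> supplies the bound \<open>i < n\<close> that
        \<open>hit\<close> requires under the quantifier.\<close>
      by (simp only: hit[OF _ V] cong: conj_cong)
  qed
  have "dF_hypercyclic T N \<rho> \<F> (x i) \<longleftrightarrow>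
        (\<forall>k\<in>{1..}. \<forall>s\<in>{1..N}. \<exists>ws. walk (\<rho> s) k (x i) ws) \<and>
        (\<forall>V. (\<forall>s\<in>{1..N}. openin T (V s) \<and> V s \<noteq> {}) \<longrightarrow>
           {k\<in>{1..}. \<forall>s\<in>{1..N}. \<exists>j<n. x j \<in> V s \<and> ?a s k i j \<ge> 1} \<in> \<F>)"
    if "i < n" for i
  proof -
    have "x i \<in> topspace T"
      using assms(1) that by (auto simp: bij_betw_def)
    \<comment> \<open>After unfolding, the two sides differ only in the order of the quantifiers
      over s and k.\<close>
    moreover have "x i \<in> (\<Inter>s\<in>{1..N}. D_inf (\<rho> s)) \<longleftrightarrow>
        (\<forall>k\<in>{1..}. \<forall>s\<in>{1..N}. \<exists>ws. walk (\<rho> s) k (x i) ws)"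
      unfolding ex_walk_iff D_inf_def by blast
    moreover have "(\<forall>V. (\<forall>s\<in>{1..N}. openin T (V s) \<and> V s \<noteq> {}) \<longrightarrow>
          {k\<in>{1..}. \<forall>s\<in>{1..N}. (\<rho> s ^^ k) `` {x i} \<inter> V s \<noteq> {}} \<in> \<F>) \<longleftrightarrow>
        (\<forall>V. (\<forall>s\<in>{1..N}. openin T (V s) \<and> V s \<noteq> {}) \<longrightarrow>
          {k\<in>{1..}. \<forall>s\<in>{1..N}. \<exists>j<n. x j \<in> V s \<and> ?a s k i j \<ge> 1} \<in> \<F>)"
      \<comment> \<open>\<open>imp_cong\<close> makes the openness of the \<open>V s\<close>
        available, which \<open>hit\<close> needs to place them inside X.\<close>
      by (intro all_cong1 imp_cong refl) (simp only: hit[OF that])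
    ultimately show ?thesis
      unfolding dF_hypercyclic_def by (simp only: simp_thms)
  qed
  moreover have "dF_topologically_transitive T N \<rho> \<F> \<longleftrightarrow>
        (\<forall>U V. openin T U \<and> U \<noteq> {} \<and> (\<forall>s\<in>{1..N}. openin T (V s) \<and> V s \<noteq> {}) \<longrightarrow>
           {k\<in>{1..}. \<exists>i<n. x i \<in> U \<and>
              (\<forall>s\<in>{1..N}. \<exists>j<n. x j \<in> V s \<and> ?a s k i j \<ge> 1)} \<in> \<F>)"
    unfolding dF_topologically_transitive_def
    by (intro all_cong1 imp_cong refl) (elim conjE, simp only: hit_set)
  ultimately show ?thesis
    by blast
qed

end
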